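(* Let $X$ be a Tychonoff space and let $\mathscr{P}$ be an ideal of closed sets in $X$ with $|X_\mathscr{P}|\geq 3$. Then $AG(C_\mathscr{P}(X))$ is triangulated.
   Context: $C(X)$ is the ring of all real valued continuous functions on the Tychonoff (completely regular Hausdorff) space $X$; $Z(f)=\{x\in X: f(x)=0\}$. An ideal of closed sets in $X$ is a nonempty family $\mathscr{P}$ of closed subsets of $X$ such that $A,B\in\mathscr{P}$ implies $A\cup B\in\mathscr{P}$, and $A\in\mathscr{P}$, $C\subset A$ with $C$ closed in $X$ implies $C\in\mathscr{P}$. $C_\mathscr{P}(X)=\{f\in C(X): cl_X(X\setminus Z(f))\in\mathscr{P}\}$, a commutative ring (possibly without identity). $X_\mathscr{P}$ is the set of all $x\in X$ having an open neighborhood $V$ with $cl_XV\in\mathscr{P}$. For a commutative ring $R$, $Z(R)^*$ is the set of nonzero zero divisors, i.e. nonzero $a\in R$ with $ab=0$ for some nonzero $b\in R$, and $ann(a)=\{r\in R: ra=0\}$. The annihilator graph $AG(R)$ is the simple graph with vertex set $Z(R)^*$ in which distinct $a,b$ are adjacent iff $ann(a)\cup ann(b)\neq ann(ab)$. A graph is triangulated if each of its vertices is a vertex of a triangle. *)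

theory Defs
  imports "HOL-Analysis.Analysis" "HOL-Algebra.Ring" "HOL-Library.Equipollence"
begin

section \<open>Rings of continuous functions\<close>

definition zero_set :: "'a topology \<Rightarrow> ('a \<Rightarrow> real) \<Rightarrow> 'a set" where
  "zero_set X f = {x \<in> topspace X. f x = 0}"

text \<open>The elements are taken extensional on the space, so that equality of ring elements
  is equality of functions on the points of \<open>X\<close>.\<close>

definition continuous_functions :: "'a topology \<Rightarrow> ('a \<Rightarrow> real) ring" where
  "continuous_functions X =
    \<lparr> carrier = {f \<in> extensional (topspace X). continuous_map X euclideanreal f},
      mult = (\<lambda>f g. \<lambda>x\<in>topspace X. f x * g x),
      one = (\<lambda>x\<in>topspace X. 1),
      zero = (\<lambda>x\<in>topspace X. 0),
      add = (\<lambda>f g. \<lambda>x\<in>topspace X. f x + g x) \<rparr>"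

definition ideal_of_closed_sets :: "'a topology \<Rightarrow> 'a set set \<Rightarrow> bool" where
  "ideal_of_closed_sets X P \<longleftrightarrow>
    P \<noteq> {} \<and>
    (\<forall>A\<in>P. closedin X A) \<and>
    (\<forall>A\<in>P. \<forall>B\<in>P. A \<union> B \<in> P) \<and>
    (\<forall>A\<in>P. \<forall>C. C \<subseteq> A \<and> closedin X C \<longrightarrow> C \<in> P)"

text \<open>The operations are inherited from \<open>C(X)\<close>. The ring need not have an identity:
  the inherited \<open>one\<close> field may lie outside the carrier and has no meaning here.\<close>

definition C_ideal :: "'a topology \<Rightarrow> 'a set set \<Rightarrow> ('a \<Rightarrow> real) ring" where
  "C_ideal X P = (continuous_functions X)
    \<lparr> carrier := {f \<in> carrier (continuous_functions X).
                    X closure_of (topspace X - zero_set X f) \<in> P} \<rparr>"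

definition ideal_points :: "'a topology \<Rightarrow> 'a set set \<Rightarrow> 'a set" where
  "ideal_points X P =
    {x \<in> topspace X. \<exists>V. openin X V \<and> x \<in> V \<and> X closure_of V \<in> P}"

section \<open>The annihilator graph\<close>

text \<open>The next definitions use only the carrier, the multiplication and the zero of \<open>R\<close>,
  so they make sense for commutative rings without identity.\<close>

definition nonzero_zero_divisors :: "('r, 'm) ring_scheme \<Rightarrow> 'r set" where
  "nonzero_zero_divisors R =
    {a \<in> carrier R. a \<noteq> \<zero>\<^bsub>R\<^esub> \<and> (\<exists>b\<in>carrier R. b \<noteq> \<zero>\<^bsub>R\<^esub> \<and> a \<otimes>\<^bsub>R\<^esub> b = \<zero>\<^bsub>R\<^esub>)}"

definition ann :: "('r, 'm) ring_scheme \<Rightarrow> 'r \<Rightarrow> 'r set" where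
  "ann R a = {r \<in> carrier R. r \<otimes>\<^bsub>R\<^esub> a = \<zero>\<^bsub>R\<^esub>}"

text \<open>Simple graphs, possibly infinite; an edge is the two-element set of its ends.\<close>

record 'v simple_graph =
  vertices :: "'v set"
  edges :: "'v set set"

definition annihilator_graph :: "('r, 'm) ring_scheme \<Rightarrow> 'r simple_graph" where
  "annihilator_graph R =
    \<lparr> vertices = nonzero_zero_divisors R,
      edges = {{a, b} | a b. a \<in> nonzero_zero_divisors R \<and> b \<in> nonzero_zero_divisors R \<and>
                 a \<noteq> b \<and> ann R a \<union> ann R b \<noteq> ann R (a \<otimes>\<^bsub>R\<^esub> b)} \<rparr>"

definition is_triangle :: "'v simple_graph \<Rightarrow> 'v \<Rightarrow> 'v \<Rightarrow> 'v \<Rightarrow> bool" where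
  "is_triangle G u v w \<longleftrightarrow>
    u \<in> vertices G \<and> v \<in> vertices G \<and> w \<in> vertices G \<and>
    u \<noteq> v \<and> v \<noteq> w \<and> u \<noteq> w \<and>
    {u, v} \<in> edges G \<and> {v, w} \<in> edges G \<and> {u, w} \<in> edges G"

definition triangulated :: "'v simple_graph \<Rightarrow> bool" where
  "triangulated G \<longleftrightarrow> (\<forall>u\<in>vertices G. \<exists>v w. is_triangle G u v w)"

end

theory Submission
  imports Defs
begin

text \<open>
  For \<open>a\<close> and \<open>b\<close> in \<open>C\<^sub>\<P>(X)\<close> the inclusion of \<open>ann a \<union> ann b\<close> in \<open>ann (ab)\<close> always holds, so
  vertices \<open>a\<close> and \<open>b\<close> are adjacent as soon as some \<open>r\<close> kills \<open>ab\<close> but neither \<open>a\<close> nor \<open>b\<close>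
  (\<open>edge_by_witness\<close>). Such a witness automatically forces \<open>a \<noteq> b\<close>, because a ring of real
  functions has no nilpotents. In particular, nonzero elements with product \<open>0\<close> are adjacent, with
  witness \<open>a + b\<close> (\<open>edge_of_orthogonal\<close>).

  Witnesses are built from bump functions: complete regularity provides, at every point of
  \<open>X\<^sub>\<P>\<close>, a member of \<open>C\<^sub>\<P>(X)\<close> that does not vanish there and vanishes off any prescribed
  neighbourhood (\<open>bump_function\<close>). Hence an open set with two points of \<open>X\<^sub>\<P>\<close> carries
  two nonzero members \<open>h\<close> and \<open>k\<close> of the ring with \<open>hk = 0\<close> (\<open>orthogonal_bumps\<close>).

  Let \<open>f\<close> be a vertex and \<open>g\<close> a nonzero member of the ring with \<open>fg = 0\<close>.
  Every point at which \<open>f\<close> does not vanish lies in \<open>X\<^sub>\<P>\<close>.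
  If \<open>f\<close> is nonzero at two points or more, take \<open>h\<close> and \<open>k\<close> as above living where \<open>f \<noteq> 0\<close>. Then
  \<open>h\<close> and \<open>k\<close> are orthogonal to \<open>g\<close>, and \<open>f\<close>, \<open>h + g\<close>, \<open>k + g\<close> is a triangle: the edge from
  \<open>f\<close> to \<open>h + g\<close> has witness \<open>k + g\<close>, the one from \<open>f\<close> to \<open>k + g\<close> has witness \<open>h + g\<close>, and the
  third one has witness \<open>h + k\<close>, since the product of \<open>h + g\<close> and \<open>k + g\<close> is \<open>g\<^sup>2\<close>.
  If \<open>f\<close> is nonzero at a single point \<open>x\<close>, then \<open>X\<^sub>\<P>\<close> still has two points other than \<open>x\<close>,
  and a pair \<open>h\<close>, \<open>k\<close> living off \<open>x\<close> makes \<open>f\<close>, \<open>h\<close>, \<open>k\<close> pairwise orthogonal.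
\<close>

section \<open>Pointwise description of the ring\<close>

lemma mult_C_ideal:
  "f \<otimes>\<^bsub>C_ideal X P\<^esub> g = (\<lambda>x\<in>topspace X. f x * g x)"
  and zero_C_ideal: "\<zero>\<^bsub>C_ideal X P\<^esub> = (\<lambda>x\<in>topspace X. 0)"
  and add_C_ideal: "f \<oplus>\<^bsub>C_ideal X P\<^esub> g = (\<lambda>x\<in>topspace X. f x + g x)"
  by (simp_all add: C_ideal_def continuous_functions_def)

lemma carrier_C_ideal_iff:
  "f \<in> carrier (C_ideal X P) \<longleftrightarrow>
    f \<in> extensional (topspace X) \<and> continuous_map X euclideanreal f \<and>
    X closure_of {x \<in> topspace X. f x \<noteq> 0} \<in> P"
proof -
  have "topspace X - zero_set X f = {x \<in> topspace X. f x \<noteq> 0}"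
    by (auto simp: zero_set_def)
  then show ?thesis
    by (simp add: C_ideal_def continuous_functions_def)
qed

lemma restrict_eq_iff:
  "(\<lambda>x\<in>A. u x) = (\<lambda>x\<in>A. v x) \<longleftrightarrow> (\<forall>x\<in>A. u x = v x)"
  by (auto simp: fun_eq_iff restrict_def)

lemma nonzero_C_ideal_iff:
  assumes "f \<in> carrier (C_ideal X P)"
  shows "f \<noteq> \<zero>\<^bsub>C_ideal X P\<^esub> \<longleftrightarrow> (\<exists>x\<in>topspace X. f x \<noteq> 0)"
proof -
  have "restrict f (topspace X) = f"
    using assms by (simp add: carrier_C_ideal_iff extensional_restrict)
  then show ?thesis
    using restrict_eq_iff[of f "topspace X" "\<lambda>_. 0"] unfolding zero_C_ideal by simp
qed

lemma zero_divisors_C_ideal_iff: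
  "f \<in> nonzero_zero_divisors (C_ideal X P) \<longleftrightarrow>
    f \<in> carrier (C_ideal X P) \<and> (\<exists>x\<in>topspace X. f x \<noteq> 0) \<and>
    (\<exists>g\<in>carrier (C_ideal X P). (\<exists>x\<in>topspace X. g x \<noteq> 0) \<and>
      (\<forall>x\<in>topspace X. f x * g x = 0))"
proof (cases "f \<in> carrier (C_ideal X P)")
  case True
  have "f \<otimes>\<^bsub>C_ideal X P\<^esub> g = \<zero>\<^bsub>C_ideal X P\<^esub> \<longleftrightarrow> (\<forall>x\<in>topspace X. f x * g x = 0)" for g
    unfolding mult_C_ideal zero_C_ideal restrict_eq_iff by simp
  with True show ?thesis
    unfolding nonzero_zero_divisors_def by (simp add: nonzero_C_ideal_iff cong: bex_cong)
qed (simp add: nonzero_zero_divisors_def)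

lemma ideal_of_closed_sets_closure_mono:
  assumes "ideal_of_closed_sets X P" and "X closure_of A \<subseteq> B" and "B \<in> P"
  shows "X closure_of A \<in> P"
  using assms closedin_closure_of[of X A] unfolding ideal_of_closed_sets_def by blast

lemma add_closed_C_ideal:
  assumes P: "ideal_of_closed_sets X P"
    and f: "f \<in> carrier (C_ideal X P)" and g: "g \<in> carrier (C_ideal X P)"
  shows "f \<oplus>\<^bsub>C_ideal X P\<^esub> g \<in> carrier (C_ideal X P)"
proof -
  let ?s = "\<lambda>x\<in>topspace X. f x + g x"
  let ?F = "{x \<in> topspace X. f x \<noteq> 0}" and ?G = "{x \<in> topspace X. g x \<noteq> 0}"
  have "continuous_map X euclideanreal (\<lambda>x. f x + g x)"
    using f g by (intro continuous_map_add) (simp_all add: carrier_C_ideal_iff)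
  then have cont: "continuous_map X euclideanreal ?s"
    by (rule continuous_map_eq) simp
  let ?cl = "\<lambda>A. X closure_of A"
  have "{x \<in> topspace X. ?s x \<noteq> 0} \<subseteq> ?F \<union> ?G"
    by auto
  then have "?cl {x \<in> topspace X. ?s x \<noteq> 0} \<subseteq> ?cl ?F \<union> ?cl ?G"
    unfolding closure_of_Un[symmetric] by (rule closure_of_mono)
  moreover have "?cl ?F \<union> ?cl ?G \<in> P"
    using P f g by (simp add: carrier_C_ideal_iff ideal_of_closed_sets_def)
  ultimately have "?cl {x \<in> topspace X. ?s x \<noteq> 0} \<in> P"
    by (rule ideal_of_closed_sets_closure_mono[OF P])
  with cont show ?thesis
    unfolding add_C_ideal carrier_C_ideal_iff by simp
qed

lemma openin_nonvanishing:
  assumes "f \<in> carrier (C_ideal X P)"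
  shows "openin X {x \<in> topspace X. f x \<noteq> 0}"
proof -
  have "openin X {x \<in> topspace X. f x \<in> - {0}}"
    using assms by (intro openin_continuous_map_preimage[where Y = euclideanreal])
      (auto simp: carrier_C_ideal_iff)
  then show ?thesis by simp
qed

lemma nonvanishing_subset_ideal_points:
  assumes "f \<in> carrier (C_ideal X P)"
  shows "{x \<in> topspace X. f x \<noteq> 0} \<subseteq> ideal_points X P"
  using openin_nonvanishing[OF assms] assms
  unfolding ideal_points_def carrier_C_ideal_iff by blast

section \<open>Edges\<close>

text \<open>The witness \<open>r\<close> lies in the annihilator of \<open>ab\<close> but in neither annihilator of a factor.
  If \<open>a\<close> and \<open>b\<close> were equal, \<open>rab = 0\<close> would give \<open>ra = 0\<close> at every point, which is
  why the witness also separates the two vertices.\<close>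
lemma edge_by_witness:
  assumes a: "a \<in> nonzero_zero_divisors (C_ideal X P)"
    and b: "b \<in> nonzero_zero_divisors (C_ideal X P)"
    and r: "r \<in> carrier (C_ideal X P)"
    and ra: "\<exists>x\<in>topspace X. r x * a x \<noteq> 0" and rb: "\<exists>x\<in>topspace X. r x * b x \<noteq> 0"
    and rab: "\<forall>x\<in>topspace X. r x * (a x * b x) = 0"
  shows "a \<noteq> b \<and> {a, b} \<in> edges (annihilator_graph (C_ideal X P))"
proof -
  have "a \<noteq> b"
    using ra rab by auto
  moreover have "r \<in> ann (C_ideal X P) (a \<otimes>\<^bsub>C_ideal X P\<^esub> b)"
    using r rab unfolding ann_def mult_C_ideal zero_C_ideal by (simp add: restrict_eq_iff)
  moreover have "r \<notin> ann (C_ideal X P) a \<union> ann (C_ideal X P) b"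
    using ra rb unfolding ann_def mult_C_ideal zero_C_ideal by (auto simp: restrict_eq_iff)
  ultimately show ?thesis
    using a b unfolding annihilator_graph_def by auto
qed

lemma edge_of_orthogonal:
  assumes P: "ideal_of_closed_sets X P"
    and a: "a \<in> nonzero_zero_divisors (C_ideal X P)"
    and b: "b \<in> nonzero_zero_divisors (C_ideal X P)"
    and ab: "\<forall>x\<in>topspace X. a x * b x = 0"
  shows "a \<noteq> b \<and> {a, b} \<in> edges (annihilator_graph (C_ideal X P))"
proof (rule edge_by_witness[OF a b])
  let ?s = "a \<oplus>\<^bsub>C_ideal X P\<^esub> b"
  have s: "?s x = a x + b x" if "x \<in> topspace X" for x
    using that by (simp add: add_C_ideal)
  show "?s \<in> carrier (C_ideal X P)"
    using add_closed_C_ideal[OF P] a b by (simp add: zero_divisors_C_ideal_iff)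
  obtain p where p: "p \<in> topspace X" "a p \<noteq> 0"
    using a unfolding zero_divisors_C_ideal_iff by blast
  then show "\<exists>x\<in>topspace X. ?s x * a x \<noteq> 0"
    using ab s by (intro bexI[of _ p]) auto
  obtain q where q: "q \<in> topspace X" "b q \<noteq> 0"
    using b unfolding zero_divisors_C_ideal_iff by blast
  then show "\<exists>x\<in>topspace X. ?s x * b x \<noteq> 0"
    using ab s by (intro bexI[of _ q]) auto
  show "\<forall>x\<in>topspace X. ?s x * (a x * b x) = 0"
    using ab by simp
qed

section \<open>Bump functions\<close>

lemma bump_function:
  assumes cr: "completely_regular_space X" and P: "ideal_of_closed_sets X P"
    and x: "x \<in> ideal_points X P" and U: "openin X U" "x \<in> U"
  obtains h where "h \<in> carrier (C_ideal X P)" "h x \<noteq> 0"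
    "{y \<in> topspace X. h y \<noteq> 0} \<subseteq> U"
proof -
  obtain V where V: "openin X V" "x \<in> V" "X closure_of V \<in> P" and xX: "x \<in> topspace X"
    using x unfolding ideal_points_def by blast
  have "openin X (U \<inter> V)"
    using U V by blast
  then have "closedin X (topspace X - (U \<inter> V))"
    by blast
  moreover have "x \<in> topspace X - (topspace X - (U \<inter> V))"
    using xX U V by blast
  ultimately obtain e where e: "continuous_map X (top_of_set {0..1::real}) e" "e x = 0"
    "e ` (topspace X - (U \<inter> V)) \<subseteq> {1}"
    using cr unfolding completely_regular_space_def by blast
  \<comment> \<open>The function provided by complete regularity vanishes at the point and is \<open>1\<close> off the
    neighbourhood, so the bump is its complement.\<close>
  define h where "h = (\<lambda>y\<in>topspace X. 1 - e y)"
  have "continuous_map X euclideanreal (\<lambda>y. 1 - e y)"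
    using e(1) by (intro continuous_map_diff) (auto simp: continuous_map_in_subtopology)
  then have cont: "continuous_map X euclideanreal h"
    by (rule continuous_map_eq) (simp add: h_def)
  have sub: "{y \<in> topspace X. h y \<noteq> 0} \<subseteq> U \<inter> V"
    using e(3) by (auto simp: h_def)
  then have "X closure_of {y \<in> topspace X. h y \<noteq> 0} \<subseteq> X closure_of V"
    by (intro closure_of_mono) blast
  then have "X closure_of {y \<in> topspace X. h y \<noteq> 0} \<in> P"
    by (rule ideal_of_closed_sets_closure_mono[OF P _ V(3)])
  with cont have "h \<in> carrier (C_ideal X P)"
    unfolding carrier_C_ideal_iff by (simp add: h_def)
  moreover have "h x \<noteq> 0"
    using xX e(2) by (simp add: h_def)
  ultimately show thesis
    using that sub by blast
qed

lemma orthogonal_bumps: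
  assumes cr: "completely_regular_space X" and "Hausdorff_space X"
    and P: "ideal_of_closed_sets X P"
    and U: "openin X U" and y: "y \<in> ideal_points X P \<inter> U" and z: "z \<in> ideal_points X P \<inter> U"
    and "y \<noteq> z"
  obtains h k where "h \<in> carrier (C_ideal X P)" "k \<in> carrier (C_ideal X P)"
    "h y \<noteq> 0" "k z \<noteq> 0"
    "{x \<in> topspace X. h x \<noteq> 0} \<subseteq> U" "{x \<in> topspace X. k x \<noteq> 0} \<subseteq> U"
    "\<forall>x\<in>topspace X. h x * k x = 0"
proof -
  have "y \<in> topspace X" "z \<in> topspace X"
    using y z by (auto simp: ideal_points_def)
  then obtain A B where AB: "openin X A" "openin X B" "y \<in> A" "z \<in> B" "disjnt A B"
    using assms(2,7) unfolding Hausdorff_space_def by metis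
  obtain h where h: "h \<in> carrier (C_ideal X P)" "h y \<noteq> 0" "{x \<in> topspace X. h x \<noteq> 0} \<subseteq> U \<inter> A"
    using bump_function[OF cr P, of y "U \<inter> A"] y U AB by blast
  obtain k where k: "k \<in> carrier (C_ideal X P)" "k z \<noteq> 0" "{x \<in> topspace X. k x \<noteq> 0} \<subseteq> U \<inter> B"
    using bump_function[OF cr P, of z "U \<inter> B"] z U AB by blast
  have "\<forall>x\<in>topspace X. h x * k x = 0"
    using h(3) k(3) AB(5) by (auto simp: disjnt_iff)
  with h k show thesis
    using that by blast
qed

section \<open>Triangles\<close>

lemma triangle_of_orthogonal:
  assumes P: "ideal_of_closed_sets X P"
    and "f \<in> carrier (C_ideal X P)" "h \<in> carrier (C_ideal X P)" "k \<in> carrier (C_ideal X P)"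
    and "\<exists>x\<in>topspace X. f x \<noteq> 0" "\<exists>x\<in>topspace X. h x \<noteq> 0" "\<exists>x\<in>topspace X. k x \<noteq> 0"
    and fh: "\<forall>x\<in>topspace X. f x * h x = 0" and fk: "\<forall>x\<in>topspace X. f x * k x = 0"
    and hk: "\<forall>x\<in>topspace X. h x * k x = 0"
  shows "is_triangle (annihilator_graph (C_ideal X P)) f h k"
proof -
  have f: "f \<in> nonzero_zero_divisors (C_ideal X P)"
    unfolding zero_divisors_C_ideal_iff using assms by blast
  have h: "h \<in> nonzero_zero_divisors (C_ideal X P)"
    unfolding zero_divisors_C_ideal_iff using assms by blast
  have k: "k \<in> nonzero_zero_divisors (C_ideal X P)"
    unfolding zero_divisors_C_ideal_iff using assms by (metis mult.commute)
  show ?thesis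
    using edge_of_orthogonal[OF P f h fh] edge_of_orthogonal[OF P f k fk]
      edge_of_orthogonal[OF P h k hk] f h k
    unfolding is_triangle_def by (simp add: annihilator_graph_def)
qed

text \<open>Here \<open>h + g\<close> and \<open>k + g\<close> overlap only where \<open>g\<close> is nonzero, and each of them meets \<open>f\<close>
  without covering it, since the other of \<open>h\<close> and \<open>k\<close> also lives where \<open>f\<close> is nonzero. This is why
  every edge has a witness and why both functions are still zero divisors.\<close>
lemma triangle_of_split:
  assumes P: "ideal_of_closed_sets X P"
    and car: "f \<in> carrier (C_ideal X P)" "g \<in> carrier (C_ideal X P)"
      "h \<in> carrier (C_ideal X P)" "k \<in> carrier (C_ideal X P)"
    and g0: "\<exists>x\<in>topspace X. g x \<noteq> 0"
    and h0: "\<exists>x\<in>topspace X. h x \<noteq> 0" and k0: "\<exists>x\<in>topspace X. k x \<noteq> 0"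
    and fg: "\<forall>x\<in>topspace X. f x * g x = 0"
    and h: "{x \<in> topspace X. h x \<noteq> 0} \<subseteq> {x \<in> topspace X. f x \<noteq> 0}"
    and k: "{x \<in> topspace X. k x \<noteq> 0} \<subseteq> {x \<in> topspace X. f x \<noteq> 0}"
    and hk: "\<forall>x\<in>topspace X. h x * k x = 0"
  shows "is_triangle (annihilator_graph (C_ideal X P)) f
    (h \<oplus>\<^bsub>C_ideal X P\<^esub> g) (k \<oplus>\<^bsub>C_ideal X P\<^esub> g)"
proof -
  let ?Z = "nonzero_zero_divisors (C_ideal X P)" and ?E = "edges (annihilator_graph (C_ideal X P))"
  let ?v = "h \<oplus>\<^bsub>C_ideal X P\<^esub> g" and ?w = "k \<oplus>\<^bsub>C_ideal X P\<^esub> g"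
  let ?s = "h \<oplus>\<^bsub>C_ideal X P\<^esub> k"
  have v: "?v x = h x + g x" and w: "?w x = k x + g x" and s: "?s x = h x + k x"
    if "x \<in> topspace X" for x
    using that by (simp_all add: add_C_ideal)
  have carv: "?v \<in> carrier (C_ideal X P)" and carw: "?w \<in> carrier (C_ideal X P)"
    and cars: "?s \<in> carrier (C_ideal X P)"
    using add_closed_C_ideal[OF P] car by auto
  \<comment> \<open>All product computations reduce to this pointwise trichotomy.\<close>
  have gx: "f x = 0 \<and> h x = 0 \<and> k x = 0 \<or>
      f x \<noteq> 0 \<and> g x = 0 \<and> h x = 0 \<or> f x \<noteq> 0 \<and> g x = 0 \<and> k x = 0"
    if "x \<in> topspace X" for x
  proof -
    have "f x = 0 \<or> g x = 0" "h x = 0 \<or> k x = 0"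
      using that fg hk by auto
    moreover have "f x = 0 \<Longrightarrow> h x = 0 \<and> k x = 0"
      using that h k by auto
    ultimately show ?thesis by blast
  qed
  obtain p where p0: "p \<in> topspace X" "h p \<noteq> 0"
    using h0 by blast
  have p: "p \<in> topspace X" "h p \<noteq> 0" "f p \<noteq> 0" "g p = 0" "k p = 0"
    using gx[OF p0(1)] p0 by auto
  obtain q where q0: "q \<in> topspace X" "k q \<noteq> 0"
    using k0 by blast
  have q: "q \<in> topspace X" "k q \<noteq> 0" "f q \<noteq> 0" "g q = 0" "h q = 0"
    using gx[OF q0(1)] q0 by auto
  obtain t where t0: "t \<in> topspace X" "g t \<noteq> 0"
    using g0 by blast
  have t: "t \<in> topspace X" "g t \<noteq> 0" "f t = 0" "h t = 0" "k t = 0"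
    using gx[OF t0(1)] t0 by auto
  have f: "f \<in> ?Z"
    unfolding zero_divisors_C_ideal_iff using car fg g0 p by blast
  have vk: "\<forall>x\<in>topspace X. ?v x * k x = 0" and wh: "\<forall>x\<in>topspace X. ?w x * h x = 0"
    using gx by (fastforce simp: v w)+
  have v0: "\<exists>x\<in>topspace X. ?v x \<noteq> 0" and w0: "\<exists>x\<in>topspace X. ?w x \<noteq> 0"
    using t v w by (auto intro!: bexI[of _ t])
  have vz: "?v \<in> ?Z"
    unfolding zero_divisors_C_ideal_iff using carv car(4) vk v0 k0 by blast
  have wz: "?w \<in> ?Z"
    unfolding zero_divisors_C_ideal_iff using carw car(3) wh w0 h0 by blast
  have "f \<noteq> ?v \<and> {f, ?v} \<in> ?E"
  proof (rule edge_by_witness[OF f vz carw])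
    show "\<exists>x\<in>topspace X. ?w x * f x \<noteq> 0"
      using q w by (intro bexI[of _ q]) auto
    show "\<exists>x\<in>topspace X. ?w x * ?v x \<noteq> 0"
      using t v w by (intro bexI[of _ t]) auto
    show "\<forall>x\<in>topspace X. ?w x * (f x * ?v x) = 0"
      using gx by (fastforce simp: v w)
  qed
  moreover have "f \<noteq> ?w \<and> {f, ?w} \<in> ?E"
  proof (rule edge_by_witness[OF f wz carv])
    show "\<exists>x\<in>topspace X. ?v x * f x \<noteq> 0"
      using p v by (intro bexI[of _ p]) auto
    show "\<exists>x\<in>topspace X. ?v x * ?w x \<noteq> 0"
      using t v w by (intro bexI[of _ t]) auto
    show "\<forall>x\<in>topspace X. ?v x * (f x * ?w x) = 0"
      using gx by (fastforce simp: v w)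
  qed
  moreover have "?v \<noteq> ?w \<and> {?v, ?w} \<in> ?E"
  proof (rule edge_by_witness[OF vz wz cars])
    show "\<exists>x\<in>topspace X. ?s x * ?v x \<noteq> 0"
      using p v s by (intro bexI[of _ p]) auto
    show "\<exists>x\<in>topspace X. ?s x * ?w x \<noteq> 0"
      using q w s by (intro bexI[of _ q]) auto
    show "\<forall>x\<in>topspace X. ?s x * (?v x * ?w x) = 0"
      using gx by (fastforce simp: v w s)
  qed
  ultimately show ?thesis
    using f vz wz unfolding is_triangle_def by (simp add: annihilator_graph_def)
qed

lemma two_points_avoiding:
  assumes "{..<3::nat} \<lesssim> S"
  obtains y z where "y \<in> S" "z \<in> S" "y \<noteq> z" "y \<noteq> x" "z \<noteq> x"
proof -
  obtain e where e: "inj_on e {..<3::nat}" "e ` {..<3} \<subseteq> S"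
    using assms unfolding lepoll_def by blast
  have "e 0 \<noteq> e 1" "e 1 \<noteq> e 2" "e 0 \<noteq> e 2"
    using e(1) by (simp_all add: inj_on_eq_iff)
  moreover have "e 0 \<in> S" "e 1 \<in> S" "e 2 \<in> S"
    using e(2) by auto
  ultimately show thesis
    using that by metis
qed

theorem theorem3p13:
  fixes X :: "'a topology" and P :: "'a set set"
  assumes "completely_regular_space X" and "Hausdorff_space X"
    and "ideal_of_closed_sets X P"
    and "{..<3::nat} \<lesssim> ideal_points X P"
  shows "triangulated (annihilator_graph (C_ideal X P))"
  unfolding triangulated_def
proof
  fix f
  assume "f \<in> vertices (annihilator_graph (C_ideal X P))"
  then have "f \<in> nonzero_zero_divisors (C_ideal X P)"
    by (simp add: annihilator_graph_def)
  then obtain x g where f: "f \<in> carrier (C_ideal X P)" and x: "x \<in> topspace X" "f x \<noteq> 0"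
    and g: "g \<in> carrier (C_ideal X P)" "\<exists>x\<in>topspace X. g x \<noteq> 0"
      "\<forall>x\<in>topspace X. f x * g x = 0"
    unfolding zero_divisors_C_ideal_iff by blast
  let ?A = "{x \<in> topspace X. f x \<noteq> 0}"
  note bumps = orthogonal_bumps[OF assms(1-3)]
  show "\<exists>v w. is_triangle (annihilator_graph (C_ideal X P)) f v w"
  proof (cases "?A = {x}")
    case True
    obtain y z where yz: "y \<in> ideal_points X P" "z \<in> ideal_points X P" "y \<noteq> z" "y \<noteq> x" "z \<noteq> x"
      using two_points_avoiding[OF assms(4)] by blast
    then have yzX: "y \<in> topspace X" "z \<in> topspace X"
      by (auto simp: ideal_points_def)
    have off: "openin X (topspace X - {x})"
      using closedin_Hausdorff_singleton[OF assms(2) x(1)] by blast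
    have mem: "y \<in> ideal_points X P \<inter> (topspace X - {x})"
      "z \<in> ideal_points X P \<inter> (topspace X - {x})"
      using yz yzX by auto
    obtain h k where hk: "h \<in> carrier (C_ideal X P)" "k \<in> carrier (C_ideal X P)"
      "h y \<noteq> 0" "k z \<noteq> 0" "{y \<in> topspace X. h y \<noteq> 0} \<subseteq> topspace X - {x}"
      "{y \<in> topspace X. k y \<noteq> 0} \<subseteq> topspace X - {x}" "\<forall>x\<in>topspace X. h x * k x = 0"
      by (rule bumps[OF off mem yz(3)])
    have "\<forall>y\<in>topspace X. f y * h y = 0" "\<forall>y\<in>topspace X. f y * k y = 0"
      using hk(5,6) True by auto
    then have "is_triangle (annihilator_graph (C_ideal X P)) f h k"
      using triangle_of_orthogonal[OF assms(3) f hk(1,2)] hk(3,4,7) x yzX by blast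
    then show ?thesis by blast
  next
    case False
    then obtain y where y: "y \<in> ?A" "x \<noteq> y"
      using x by blast
    have mem: "x \<in> ideal_points X P \<inter> ?A" "y \<in> ideal_points X P \<inter> ?A"
      using nonvanishing_subset_ideal_points[OF f] x y by auto
    obtain h k where hk: "h \<in> carrier (C_ideal X P)" "k \<in> carrier (C_ideal X P)"
      "h x \<noteq> 0" "k y \<noteq> 0" "{x \<in> topspace X. h x \<noteq> 0} \<subseteq> ?A" "{x \<in> topspace X. k x \<noteq> 0} \<subseteq> ?A"
      "\<forall>x\<in>topspace X. h x * k x = 0"
      by (rule bumps[OF openin_nonvanishing[OF f] mem y(2)])
    have "\<exists>x\<in>topspace X. h x \<noteq> 0" "\<exists>x\<in>topspace X. k x \<noteq> 0"
      using hk(3,4) x y by auto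
    then show ?thesis
      using triangle_of_split[OF assms(3) f g(1) hk(1,2) g(2) _ _ g(3) hk(5,6,7)] by blast
  qed
qed

end
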